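(* Let $X := [0,1]/(0\sim 1)$. The set of numbers in $X$ with bounded L\"uroth expansion is $\alpha$-winning and $\alpha$-strong winning for $\alpha := \frac18$.
   Context: **L\"uroth expansions.** $X=[0,1]/(0\sim1)$ is the circle of length one, with its usual arc-length metric; points are represented by $x\in[0,1)$. Define $T:X\to X$ by $Tx = n(n+1)x-n$ if $x\in[\frac1{n+1},\frac1n)$ for an integer $n\ge 1$, and $T0=0$. For $x\neq 0$ the first digit is $a_1(x)=n+1$ if $x\in[\frac1{n+1},\frac1n)$, $n\geq 1$, and the $k$-th digit is $a_k(x)=a_1(T^{k-1}x)$ as long as $T^{k-1}x\ne 0$; when $T^{k-1}x=0$ there is no $k$-th digit and the process stops (finite expansion). The digits are integers $\ge 2$, and the L\"uroth expansion of $x$ is the finite or infinite series $$x=\frac1{a_1}+\frac1{a_1(a_1-1)a_2}+\cdots+\frac1{a_1(a_1-1)\cdots a_{k-1}(a_{k-1}-1)a_k}+\cdots,\qquad a_k=a_k(x).$$ The number $0$ has no L\"uroth expansion. A number $x$ has bounded L\"uroth expansion if there is a natural number $N(x)$ such that $a_k(x)\le N(x)$ for all digits $a_k(x)$ of $x$; in particular finite L\"uroth expansions are bounded. **Schmidt games.** Let $M$ be a complete metric space, $S\subset M$, $0<\alpha<1$, $0<\beta<1$, and let $\rho(\cdot)$ denote the radius of a closed ball. Balls have nonempty interior. (In $X$, closed balls are closed arcs and the radius is half the length.) Player $B$ and Player $A$ alternately choose nested closed balls $B_1\supset A_1\supset B_2\supset A_2\supset\cdots$ in $M$, with Player $B$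 choosing the balls $B_n$ ($B_1$ freely) and Player $A$ the balls $A_n$, subject to $\rho(A_n)=\alpha\rho(B_n)$ and $\rho(B_n)=\beta\rho(A_{n-1})$. Player $A$ wins if the intersection of these balls lies in $S$. The set $S$ is $(\alpha,\beta)$-winning if Player $A$ can always win for the given $\alpha$ and $\beta$; it is $\alpha$-winning if Player $A$ can always win for the given $\alpha$ and every $\beta\in(0,1)$. The set $S$ is $\alpha$-strong winning if the same holds (for the given $\alpha$ and every $\beta\in(0,1)$) for the variant of the game in which the radius rules are replaced by $\rho(A_n)\ge\alpha\rho(B_n)$ and $\rho(B_n)\ge\beta\rho(A_{n-1})$. *)

theory Defs
  imports "HOL-Analysis.Analysis"
begin

text \<open>
  A closed ball of a metric space, as a set, need not determine its radius, and Schmidt's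
  radius rules refer to ``the radius'' of a ball.  The parameter \<open>rho\<close> fixes, for every closed
  ball of positive radius, one of its radii.
\<close>

locale schmidt_game = Metric_space M d
  for M :: "'a set" and d :: "'a \<Rightarrow> 'a \<Rightarrow> real" +
  fixes rho :: "'a set \<Rightarrow> real"
  assumes complete: "mcomplete"
    and rho_radius:
      "\<lbrakk>c \<in> M; 0 < r\<rbrakk> \<Longrightarrow>
         0 < rho (mcball c r) \<and> (\<exists>c'\<in>M. mcball c r = mcball c' (rho (mcball c r)))"
begin

definition game_ball :: "'a set \<Rightarrow> bool" where
  "game_ball D \<longleftrightarrow> (\<exists>c\<in>M. \<exists>r>0. D = mcball c r)"

text \<open>
  Here \<open>cmp\<close> is \<open>(=)\<close> in Schmidt's original game and \<open>(\<ge>)\<close> in the strong game.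
\<close>

definition admissible :: "(real \<Rightarrow> real \<Rightarrow> bool) \<Rightarrow> real \<Rightarrow> 'a set \<Rightarrow> 'a set \<Rightarrow> bool" where
  "admissible cmp \<gamma> D E \<longleftrightarrow> game_ball E \<and> E \<subseteq> D \<and> cmp (rho E) (\<gamma> * rho D)"

text \<open>
  The moves are numbered from 0, so \<open>B 0, A 0, B 1, A 1, \<dots>\<close> is the course of the game.
\<close>

definition legal_B ::
  "(real \<Rightarrow> real \<Rightarrow> bool) \<Rightarrow> real \<Rightarrow> (nat \<Rightarrow> 'a set) \<Rightarrow> (nat \<Rightarrow> 'a set) \<Rightarrow> nat \<Rightarrow> bool" where
  "legal_B cmp \<beta> A B n \<longleftrightarrow>
     (case n of 0 \<Rightarrow> game_ball (B 0) | Suc m \<Rightarrow> admissible cmp \<beta> (A m) (B (Suc m)))"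

definition legal_A ::
  "(real \<Rightarrow> real \<Rightarrow> bool) \<Rightarrow> real \<Rightarrow> (nat \<Rightarrow> 'a set) \<Rightarrow> (nat \<Rightarrow> 'a set) \<Rightarrow> nat \<Rightarrow> bool" where
  "legal_A cmp \<alpha> A B n \<longleftrightarrow> admissible cmp \<alpha> (B n) (A n)"

text \<open>
  A strategy \<open>\<sigma>\<close> of Player A maps the list of the balls played by Player B so far to the
  answer of Player A (whose own earlier moves are determined by \<open>\<sigma>\<close>).  A winning strategy
  has to produce a legal move as long as Player B has moved legally, whether or not the
  game is continued afterwards.
\<close>

definition answers :: "('a set list \<Rightarrow> 'a set) \<Rightarrow> (nat \<Rightarrow> 'a set) \<Rightarrow> nat \<Rightarrow> 'a set" where
  "answers \<sigma> B n = \<sigma> (map B [0..<Suc n])"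

definition winning_strategy ::
  "(real \<Rightarrow> real \<Rightarrow> bool) \<Rightarrow> real \<Rightarrow> real \<Rightarrow> 'a set \<Rightarrow> ('a set list \<Rightarrow> 'a set) \<Rightarrow> bool" where
  "winning_strategy cmp \<alpha> \<beta> S \<sigma> \<longleftrightarrow>
     (\<forall>B. (\<forall>n. (\<forall>m\<le>n. legal_B cmp \<beta> (answers \<sigma> B) B m) \<longrightarrow> legal_A cmp \<alpha> (answers \<sigma> B) B n) \<and>
          ((\<forall>n. legal_B cmp \<beta> (answers \<sigma> B) B n) \<longrightarrow> (\<Inter>n. B n \<inter> answers \<sigma> B n) \<subseteq> S))"

definition alpha_beta_winning :: "real \<Rightarrow> real \<Rightarrow> 'a set \<Rightarrow> bool" where
  "alpha_beta_winning \<alpha> \<beta> S \<longleftrightarrow> (\<exists>\<sigma>. winning_strategy (=) \<alpha> \<beta> S \<sigma>)"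

definition alpha_winning :: "real \<Rightarrow> 'a set \<Rightarrow> bool" where
  "alpha_winning \<alpha> S \<longleftrightarrow> (\<forall>\<beta>. 0 < \<beta> \<and> \<beta> < 1 \<longrightarrow> alpha_beta_winning \<alpha> \<beta> S)"

definition alpha_strong_winning :: "real \<Rightarrow> 'a set \<Rightarrow> bool" where
  "alpha_strong_winning \<alpha> S \<longleftrightarrow>
     (\<forall>\<beta>. 0 < \<beta> \<and> \<beta> < 1 \<longrightarrow> (\<exists>\<sigma>. winning_strategy (\<ge>) \<alpha> \<beta> S \<sigma>))"

end

text \<open>
  The circle \<open>[0,1]/(0 \<sim> 1)\<close> is represented by \<open>[0,1)\<close>.  The outer absolute value in
  \<open>arc_dist\<close> is redundant on the circle; it makes the function nonnegative on all reals.
\<close>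

definition circle :: "real set" where
  "circle = {0..<1}"

definition arc_dist :: "real \<Rightarrow> real \<Rightarrow> real" where
  "arc_dist x y = min \<bar>x - y\<bar> \<bar>1 - \<bar>x - y\<bar>\<bar>"

text \<open>Half the length of an arc.\<close>

definition arc_radius :: "real set \<Rightarrow> real" where
  "arc_radius D = measure lborel D / 2"

lemma arc_dist_nonneg: "0 \<le> arc_dist x y"
  by (simp add: arc_dist_def)

lemma Metric_space_circle: "Metric_space circle arc_dist"
  by unfold_locales (auto simp: arc_dist_def circle_def min_def abs_if split: if_splits)

lemma circle_mcball:
  "Metric_space.mcball circle arc_dist c r =
     {y. c \<in> circle \<and> y \<in> circle \<and> (\<bar>c - y\<bar> \<le> r \<or> 1 - \<bar>c - y\<bar> \<le> r)}"
  unfolding Metric_space.mcball_def[OF Metric_space_circle]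
  by (auto simp: arc_dist_def circle_def)

lemma mcomplete_circle: "Metric_space.mcomplete circle arc_dist"
proof -
  interpret Metric_space circle arc_dist by (rule Metric_space_circle)
  show ?thesis
    unfolding mcomplete_def
  proof (intro allI impI)
    fix s assume s: "MCauchy s"
    then have rng: "\<And>n. s n \<in> circle" unfolding MCauchy_def by auto
    have "\<And>n. s n \<in> {0..1}" using rng by (auto simp: circle_def less_imp_le)
    then obtain l r where l: "l \<in> {0..1}" and r: "strict_mono (r::nat\<Rightarrow>nat)"
      and lim: "(s \<circ> r) \<longlonglongrightarrow> l"
      using compact_Icc[of "0::real" 1] unfolding compact_def by metis
    define l' where "l' = (if l = 1 then 0 else l)"
    have l': "l' \<in> circle" using l by (auto simp: l'_def circle_def)
    have le: "arc_dist x l' \<le> \<bar>x - l\<bar>" if "x \<in> circle" for x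
      using that l by (auto simp: arc_dist_def l'_def circle_def min_def abs_if)
    have "limitin mtopology (s \<circ> r) l' sequentially"
      unfolding limit_metric_sequentially
    proof (intro conjI l' allI impI)
      fix e :: real assume "e > 0"
      then obtain N where N: "\<And>n. n \<ge> N \<Longrightarrow> dist ((s \<circ> r) n) l < e"
        using lim unfolding lim_sequentially by blast
      show "\<exists>N. \<forall>n\<ge>N. (s \<circ> r) n \<in> circle \<and> arc_dist ((s \<circ> r) n) l' < e"
        using N le rng by (intro exI[of _ N]) (fastforce simp: dist_real_def intro: le_less_trans)
    qed
    then show "\<exists>x. limitin mtopology s x sequentially"
      using MCauchy_convergent_subsequence[OF s r] by blast
  qed
qed

lemma circle_mcball_min:
  assumes "0 < r"
  shows "Metric_space.mcball circle arc_dist c r = Metric_space.mcball circle arc_dist c (min r (1/2))"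
  using assms unfolding circle_mcball by (auto simp: circle_def min_def abs_if split: if_splits)

lemma arc_radius_mcball:
  assumes c: "c \<in> circle" and r: "0 < r" "r \<le> 1/2"
  shows "arc_radius (Metric_space.mcball circle arc_dist c r) = r"
proof -
  let ?D = "Metric_space.mcball circle arc_dist c r"
  consider "r = 1/2" | "r < 1/2" "c - r < 0" | "r < 1/2" "c + r \<ge> 1"
    | "r < 1/2" "c - r \<ge> 0" "c + r < 1" using r by linarith
  then have "measure lborel ?D = 2 * r"
  proof cases
    case 1
    then have "?D = {0..<1}" using c unfolding circle_mcball by (auto simp: circle_def abs_if)
    then show ?thesis by (simp only: 1) simp
  next
    case 2
    then have D: "?D = {0..c+r} \<union> {c-r+1..<1}"
      using c r unfolding circle_mcball by (auto simp: circle_def abs_if split: if_splits)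
    have "measure lborel ?D = measure lborel {0..c+r} + measure lborel {c-r+1..<1}"
      unfolding D using c r 2 by (intro measure_Union) (auto simp: circle_def)
    then show ?thesis using c r 2 by (simp add: circle_def)
  next
    case 3
    then have D: "?D = {0..c+r-1} \<union> {c-r..<1}"
      using c r unfolding circle_mcball by (auto simp: circle_def abs_if split: if_splits)
    have "measure lborel ?D = measure lborel {0..c+r-1} + measure lborel {c-r..<1}"
      unfolding D using c r 3 by (intro measure_Union) (auto simp: circle_def)
    then show ?thesis using c r 3 by (simp add: circle_def)
  next
    case 4
    then have "?D = {c-r..c+r}"
      using c r unfolding circle_mcball by (auto simp: circle_def abs_if split: if_splits)
    then show ?thesis using r by simp
  qed
  then show ?thesis by (simp add: arc_radius_def)
qed

interpretation circle: schmidt_game circle arc_dist arc_radius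
proof -
  interpret Metric_space circle arc_dist by (rule Metric_space_circle)
  show "schmidt_game circle arc_dist arc_radius"
  proof
    show "mcomplete" by (rule mcomplete_circle)
    fix c r :: real assume c: "c \<in> circle" and r: "0 < r"
    have "arc_radius (mcball c r) = min r (1/2)"
      using arc_radius_mcball[OF c, of "min r (1/2)"] r circle_mcball_min[OF r, of c] by simp
    then show "0 < arc_radius (mcball c r) \<and>
        (\<exists>c'\<in>circle. mcball c r = mcball c' (arc_radius (mcball c r)))"
      using c r circle_mcball_min[OF r, of c] by auto
  qed
qed

definition luroth_branch :: "real \<Rightarrow> nat" where
  "luroth_branch x = (THE n. 1 \<le> n \<and> x \<in> {1 / (real n + 1)..<1 / real n})"

definition luroth_map :: "real \<Rightarrow> real" where
  "luroth_map x =
     (if x = 0 then 0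
      else real (luroth_branch x) * (real (luroth_branch x) + 1) * x - real (luroth_branch x))"

text \<open>
  The \<open>k\<close>-th digit, \<open>k \<ge> 1\<close>, exists iff \<open>(luroth_map ^^ (k - 1)) x \<noteq> 0\<close>; the value of
  \<open>luroth_digit k x\<close> is irrelevant otherwise.
\<close>

definition has_luroth_digit :: "nat \<Rightarrow> real \<Rightarrow> bool" where
  "has_luroth_digit k x \<longleftrightarrow> 1 \<le> k \<and> (luroth_map ^^ (k - 1)) x \<noteq> 0"

definition luroth_digit :: "nat \<Rightarrow> real \<Rightarrow> nat" where
  "luroth_digit k x = luroth_branch ((luroth_map ^^ (k - 1)) x) + 1"

text \<open>The point 0 has no expansion at all, hence is excluded.\<close>

definition bounded_luroth :: "real set" where
  "bounded_luroth =
     {x \<in> circle. x \<noteq> 0 \<and> (\<exists>N. \<forall>k. has_luroth_digit k x \<longrightarrow> luroth_digit k x \<le> N)}"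

lemma luroth_branch_unique:
  assumes "x \<in> circle" "x \<noteq> 0"
  shows "\<exists>!n::nat. 1 \<le> n \<and> x \<in> {1 / (real n + 1)..<1 / real n}"
proof (rule ex_ex1I)
  have x: "0 < x" "x < 1" using assms by (auto simp: circle_def)
  define n where "n = nat (\<lceil>1/x\<rceil> - 1)"
  have gt: "1/x > 1" using x by simp
  then have n: "real n = of_int \<lceil>1/x\<rceil> - 1" "1 \<le> n" unfolding n_def by linarith+
  then have "real n < 1/x" "1/x \<le> real n + 1" by linarith+
  then have "x \<in> {1 / (real n + 1)..<1 / real n}" using x n(2) by (auto simp: field_simps)
  with n(2) show "\<exists>n::nat. 1 \<le> n \<and> x \<in> {1 / (real n + 1)..<1 / real n}" by blast
next
  fix n m :: nat
  assume a: "1 \<le> n \<and> x \<in> {1 / (real n + 1)..<1 / real n}"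
    and b: "1 \<le> m \<and> x \<in> {1 / (real m + 1)..<1 / real m}"
  have x: "0 < x" using assms by (auto simp: circle_def)
  have "real n < 1/x" "1/x \<le> real n + 1" using a x by (auto simp: field_simps)
  moreover have "real m < 1/x" "1/x \<le> real m + 1" using b x by (auto simp: field_simps)
  ultimately show "n = m" by linarith
qed

end

theory Submission
  imports Defs
begin

text \<open>
  A digit of \<open>x\<close> is large exactly when \<open>x\<close> lies just to the right of the left endpoint \<open>p\<close> of one
  of the cylinders containing it, closely in comparison with the length \<open>l\<close> of that cylinder.
  Player A therefore keeps the limit point \<open>x\<close> at least \<open>\<epsilon> * l\<close> to the right of the left endpoint of every
  cylinder around it, for some \<open>\<epsilon> > 0\<close> that may depend on the course of the game.

  The decisive geometric fact is \<open>cylinder_separated\<close>: the left endpoints of all cylinders of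
  length at least \<open>L\<close>, of whatever depth, are \<open>L\<close>-separated.  So in a ball of radius \<open>r\<close> essentially
  one endpoint of a cylinder of length at least \<open>2 * r\<close> can do harm, and one of two
  well separated subballs of radius \<open>r / 8\<close> stays clear of the segment of length \<open>r / 2\<close> to the
  right of it (\<open>avoiding_reply\<close>).  A cylinder is treated in this way in the first round in which
  \<open>l \<ge> 2 * r\<close>, the opening round left aside.  Since every radius is at least \<open>\<beta> / 8\<close> times the previous one, \<open>l\<close> is then bounded by
  a constant multiple of \<open>r\<close>, so the distance \<open>r / 2\<close> is at least a fixed fraction of \<open>l\<close>
  (\<open>round_treating_length\<close>).

  Wrap-around on the circle is removed by the first answer of Player A, which avoids the point 0;
  from then on all balls are intervals inside \<open>(0, 1)\<close>.  The answers depend only on the last ball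
  of Player B and have exactly \<open>1 / 8\<close> of its radius, and the analysis uses only the
  inequalities of the strong game, so that the same strategy wins both games.
\<close>

section \<open>Cylinders of the Lueroth map\<close>

text \<open>
  \<open>cylinder p l\<close> says that \<open>[p, p + l)\<close> is a cylinder.  Extending at the outer end of the word of
  digits, by the inverse branches \<open>x \<mapsto> (x + n) / (n * (n + 1))\<close>, makes two cylinders with the same
  first digit affine copies of two shallower ones, which is what the induction for the separation
  of endpoints needs.
\<close>

inductive cylinder :: "real \<Rightarrow> real \<Rightarrow> bool" where
  whole: "cylinder 0 1"
| branch: "\<lbrakk>cylinder p l; 1 \<le> n\<rbrakk> \<Longrightarrow>
    cylinder ((p + real n) / (real n * (real n + 1))) (l / (real n * (real n + 1)))"

lemma cylinder_bounds:
  assumes "cylinder p l"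
  shows "0 \<le> p" "0 < l" "p + l \<le> 1"
proof -
  have "0 \<le> p \<and> 0 < l \<and> p + l \<le> 1"
    using assms
  proof induction
    case whole
    then show ?case by simp
  next
    case (branch p l n)
    have d: "0 < real n * (real n + 1)" using branch.hyps by simp
    have "1 * 1 \<le> real n * real n" using branch.hyps by (intro mult_mono) auto
    then have "p + real n + l \<le> real n * (real n + 1)"
      using branch.IH branch.hyps by (simp add: algebra_simps)
    then have "(p + real n) / (real n * (real n + 1)) + l / (real n * (real n + 1)) \<le> 1"
      using d by (simp add: add_divide_distrib[symmetric])
    then show ?case using branch.IH d by simp
  qed
  then show "0 \<le> p" "0 < l" "p + l \<le> 1" by auto
qed

lemma branch_image_bounds:
  assumes "cylinder p l" "1 \<le> n"
  shows "1 / (real n + 1) \<le> (p + real n) / (real n * (real n + 1))"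
    and "(p + real n) / (real n * (real n + 1)) + l / (real n * (real n + 1)) \<le> 1 / real n"
proof -
  have n: "0 < real n" using assms(2) by simp
  have "1 / (real n + 1) = real n / (real n * (real n + 1))" using n by simp
  also have "\<dots> \<le> (p + real n) / (real n * (real n + 1))"
    using n cylinder_bounds(1)[OF assms(1)] by (intro divide_right_mono) auto
  finally show "1 / (real n + 1) \<le> (p + real n) / (real n * (real n + 1))" .
  have "(p + real n) / (real n * (real n + 1)) + l / (real n * (real n + 1))
      = (p + l + real n) / (real n * (real n + 1))"
    by (simp add: add_divide_distrib)
  also have "\<dots> \<le> (real n + 1) / (real n * (real n + 1))"
    using n cylinder_bounds(3)[OF assms(1)] by (intro divide_right_mono) auto
  also have "\<dots> = 1 / real n" using n by simp
  finally show "(p + real n) / (real n * (real n + 1)) + l / (real n * (real n + 1)) \<le> 1 / real n" .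
qed

text \<open>
  A cylinder with outer digit \<open>n + 1\<close> lies inside \<open>[1 / (n + 1), 1 / n)\<close> and has length at most
  \<open>1 / (n * (n + 1))\<close>, hence it is no longer than its distance from 0.
\<close>

lemma branch_length_le_endpoint:
  assumes "cylinder p l" "1 \<le> n"
  shows "l / (real n * (real n + 1)) \<le> (p + real n) / (real n * (real n + 1))"
  using assms cylinder_bounds[OF assms(1)] by (intro divide_right_mono) auto

lemma branch_images_separated:
  assumes "cylinder p l" "cylinder q m" "1 \<le> n" "n < k"
  shows "m / (real k * (real k + 1))
    \<le> (p + real n) / (real n * (real n + 1)) - (q + real k) / (real k * (real k + 1))"
proof -
  have "1 / real k \<le> 1 / (real n + 1)"
    using assms by (intro divide_left_mono) auto
  then show ?thesis
    using branch_image_bounds(1)[OF assms(1,3)] branch_image_bounds(2)[OF assms(2), of k] assms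
    by linarith
qed

text \<open>
  Cylinders are nested or disjoint.  For disjoint ones the left one fits between the two endpoints.
  For nested ones the reason is \<open>branch_length_le_endpoint\<close>: already the children of
  a cylinder are no longer than their distance from its left endpoint.
\<close>

lemma cylinder_separated:
  assumes "cylinder p l" "cylinder q m" "p \<noteq> q"
  shows "min l m \<le> \<bar>p - q\<bar>"
  using assms
proof (induction arbitrary: q m)
  case whole
  from whole.prems(1) show ?case
  proof cases
    case whole
    with \<open>0 \<noteq> q\<close> show ?thesis by simp
  next
    case (branch p' l' n)
    then show ?thesis using branch_length_le_endpoint[of p' l' n] by linarith
  qed
next
  case (branch p l n)
  from branch.prems(1) show ?case
  proof cases
    case whole
    then show ?thesis using branch_length_le_endpoint[OF branch.hyps] by linarith
  next
    case q: (branch q' m' k)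
    consider "n = k" | "n < k" | "k < n" by linarith
    then show ?thesis
    proof cases
      case 1
      let ?d = "real n * (real n + 1)"
      have d: "0 < ?d" using branch.hyps by simp
      have "min l m' \<le> \<bar>p - q'\<bar>"
        using branch.IH[of q' m'] branch.prems(2) q 1 by auto
      then have "min l m' / ?d \<le> \<bar>p - q'\<bar> / ?d" using d by (intro divide_right_mono) auto
      moreover have "min l m' / ?d = min (l / ?d) (m' / ?d)"
        using d by (simp add: min_divide_distrib_right)
      moreover have "(p + real n) / ?d - (q' + real n) / ?d = (p - q') / ?d"
        by (simp add: diff_divide_distrib[symmetric])
      ultimately show ?thesis using q 1 d by (simp add: abs_divide)
    next
      case 2
      then show ?thesis using branch_images_separated[OF branch.hyps(1) q(3) branch.hyps(2) 2] q
        by linarith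
    next
      case 3
      then show ?thesis using branch_images_separated[OF q(3) branch.hyps(1) q(4) 3] q
        by linarith
    qed
  qed
qed

lemma luroth_branch_bounds:
  assumes "x \<in> circle" "x \<noteq> 0"
  shows "1 \<le> luroth_branch x" "x \<in> {1 / (real (luroth_branch x) + 1)..<1 / real (luroth_branch x)}"
  using theI'[OF luroth_branch_unique[OF assms]] unfolding luroth_branch_def by auto

lemma luroth_map_inverse_branch:
  assumes "x \<in> circle" "x \<noteq> 0"
  shows "x = (luroth_map x + real (luroth_branch x))
    / (real (luroth_branch x) * (real (luroth_branch x) + 1))"
  using luroth_branch_bounds(1)[OF assms] assms(2)
  by (simp add: luroth_map_def add_nonneg_eq_0_iff)

lemma luroth_map_in_circle:
  assumes "x \<in> circle"
  shows "luroth_map x \<in> circle"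
proof (cases "x = 0")
  case True
  then show ?thesis by (simp add: luroth_map_def circle_def)
next
  case False
  define n where "n = real (luroth_branch x)"
  have n: "1 \<le> n" "1 / (n + 1) \<le> x" "x < 1 / n"
    using luroth_branch_bounds[OF assms False] by (auto simp: n_def)
  have "n * 1 \<le> n * (x * (n + 1))"
    using n by (intro mult_left_mono) (auto simp: pos_divide_le_eq)
  moreover have "(n + 1) * (x * n) < (n + 1) * 1"
    using n by (intro mult_strict_left_mono) (auto simp: pos_less_divide_eq)
  ultimately show ?thesis
    using False by (simp add: luroth_map_def circle_def n_def[symmetric] algebra_simps)
qed

lemma luroth_orbit_in_circle:
  "x \<in> circle \<Longrightarrow> (luroth_map ^^ k) x \<in> circle"
  by (induction k) (auto simp: luroth_map_in_circle)

lemma luroth_orbit_zero: "(luroth_map ^^ k) 0 = 0"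
  by (induction k) (auto simp: luroth_map_def)

text \<open>
  The cylinder of depth \<open>k\<close> around \<open>x\<close> is mapped affinely onto \<open>[0, 1)\<close> by the \<open>k\<close>-th iterate.
  Hence the next digit is large iff \<open>x - p\<close> is small compared with \<open>l\<close>.
\<close>

lemma cylinder_around:
  assumes "x \<in> circle" "(luroth_map ^^ k) x \<noteq> 0"
  obtains p l where "cylinder p l" "x = p + l * (luroth_map ^^ k) x"
proof -
  have "\<exists>p l. cylinder p l \<and> x = p + l * (luroth_map ^^ k) x"
    using assms
  proof (induction k arbitrary: x)
    case 0
    then show ?case by (intro exI[of _ 0] exI[of _ 1]) (auto intro: cylinder.whole)
  next
    case (Suc k)
    let ?y = "(luroth_map ^^ Suc k) x"
    have x0: "x \<noteq> 0" using Suc.prems(2) luroth_orbit_zero[of "Suc k"] by metis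
    have y: "(luroth_map ^^ k) (luroth_map x) = ?y" by (simp add: funpow_swap1)
    obtain p l where pl: "cylinder p l" "luroth_map x = p + l * ?y"
      using Suc.IH[OF luroth_map_in_circle[OF Suc.prems(1)]] Suc.prems(2) unfolding y by blast
    let ?n = "luroth_branch x"
    let ?d = "real ?n * (real ?n + 1)"
    have "x = (p + l * ?y + real ?n) / ?d"
      using luroth_map_inverse_branch[OF Suc.prems(1) x0] unfolding pl(2) .
    also have "\<dots> = (p + real ?n) / ?d + l / ?d * ?y"
      by (simp add: add_divide_distrib)
    finally show ?case
      using cylinder.branch[OF pl(1) luroth_branch_bounds(1)[OF Suc.prems(1) x0]] by blast
  qed
  then show ?thesis using that by blast
qed

text \<open>
  With \<open>x = p + l * y\<close> for the orbit point \<open>y\<close>, the hypothesis becomes \<open>e \<le> y\<close>, which bounds the digit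
  of \<open>y\<close> by about \<open>1 / e\<close>.
\<close>

lemma bounded_luroth_if_far_from_endpoints:
  assumes x: "x \<in> circle" and e: "0 < e"
    and far: "\<And>p l. \<lbrakk>cylinder p l; p \<le> x\<rbrakk> \<Longrightarrow> p + e * l \<le> x"
  shows "x \<in> bounded_luroth"
proof -
  have "x \<noteq> 0" using far[OF cylinder.whole] x e by (auto simp: circle_def)
  moreover have "luroth_digit k x \<le> nat \<lceil>1 / e\<rceil> + 1" if k: "has_luroth_digit k x" for k
  proof -
    define y where "y = (luroth_map ^^ (k - 1)) x"
    have y: "y \<in> circle" "y \<noteq> 0"
      using k luroth_orbit_in_circle[OF x] by (auto simp: y_def has_luroth_digit_def)
    obtain p l where pl: "cylinder p l" "x = p + l * y"
      using cylinder_around[OF x, of "k - 1"] y(2) unfolding y_def by blast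
    have l: "0 < l" using cylinder_bounds[OF pl(1)] by simp
    have "p \<le> x" using pl(2) l y(1) by (simp add: circle_def)
    then have "e * l \<le> y * l" using far[OF pl(1)] pl(2) by (simp add: mult.commute)
    then have "e \<le> y" using l by simp
    moreover have "1 \<le> luroth_branch y" "y < 1 / real (luroth_branch y)"
      using luroth_branch_bounds[OF y] by auto
    ultimately have "e * real (luroth_branch y) < 1"
      by (simp add: pos_less_divide_eq) (meson le_less_trans mult_right_mono of_nat_0_le_iff)
    then have "real (luroth_branch y) < 1 / e" using e by (simp add: pos_less_divide_eq mult.commute)
    then have "luroth_branch y \<le> nat \<lceil>1 / e\<rceil>" by linarith
    then show ?thesis by (simp add: luroth_digit_def y_def)
  qed
  ultimately show ?thesis using x unfolding bounded_luroth_def by blast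
qed

section \<open>Balls of the circle\<close>

lemma game_ballE:
  assumes "circle.game_ball D"
  obtains c r where "c \<in> circle" "0 < r" "r \<le> 1/2" "arc_radius D = r"
    "D = {y. c \<in> circle \<and> y \<in> circle \<and> (\<bar>c - y\<bar> \<le> r \<or> 1 - \<bar>c - y\<bar> \<le> r)}"
proof -
  obtain c r where cr: "c \<in> circle" "0 < r" "D = circle.mcball c r"
    using assms unfolding circle.game_ball_def by blast
  define s where "s = min r (1/2)"
  have s: "0 < s" "s \<le> 1/2" using cr(2) by (auto simp: s_def)
  have D: "D = circle.mcball c s" unfolding s_def cr(3) using cr(2) by (rule circle_mcball_min)
  show ?thesis
  proof (rule that)
    show "arc_radius D = s" unfolding D using cr(1) s by (rule arc_radius_mcball)
    show "D = {y. c \<in> circle \<and> y \<in> circle \<and> (\<bar>c - y\<bar> \<le> s \<or> 1 - \<bar>c - y\<bar> \<le> s)}"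
      unfolding D by (rule circle_mcball)
  qed (fact cr(1) s)+
qed

text \<open>A ball that misses 0 does not wrap around.\<close>

lemma game_ball_without_zeroE:
  assumes "circle.game_ball D" "0 \<notin> D"
  obtains c r where "0 < r" "0 < c - r" "c + r < 1" "arc_radius D = r" "D = {c - r..c + r}"
proof -
  obtain c r where cr: "c \<in> circle" "0 < r" "r \<le> 1/2" "arc_radius D = r"
    "D = {y. c \<in> circle \<and> y \<in> circle \<and> (\<bar>c - y\<bar> \<le> r \<or> 1 - \<bar>c - y\<bar> \<le> r)}"
    using assms(1) by (rule game_ballE)
  have lo: "0 < c - r" "c + r < 1"
    using assms(2) cr(1-3) unfolding cr(5) by (auto simp: circle_def)
  have "D = {c - r..c + r}"
  proof (intro set_eqI iffI)
    fix y assume "y \<in> D"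
    then have "0 \<le> y" "y < 1" "\<bar>c - y\<bar> \<le> r \<or> 1 - \<bar>c - y\<bar> \<le> r"
      unfolding cr(5) by (auto simp: circle_def)
    then have "\<bar>c - y\<bar> \<le> r" using lo by linarith
    then show "y \<in> {c - r..c + r}" by (simp add: abs_le_iff)
  next
    fix y assume "y \<in> {c - r..c + r}"
    then show "y \<in> D" unfolding cr(5) using lo cr(1) by (simp add: circle_def abs_le_iff)
  qed
  then show ?thesis by (rule that[OF cr(2) lo cr(4)])
qed

lemma interval_game_ball:
  assumes "0 < s" "0 < c - s" "c + s < 1"
  shows "circle.game_ball {c - s..c + s}" "arc_radius {c - s..c + s} = s"
proof -
  have c: "c \<in> circle" using assms by (simp add: circle_def)
  have "circle.mcball c s = {c - s..c + s}"
    unfolding circle_mcball using assms by (auto simp: circle_def abs_if split: if_splits)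
  then show "circle.game_ball {c - s..c + s}" "arc_radius {c - s..c + s} = s"
    using arc_radius_mcball[OF c, of s] assms c unfolding circle.game_ball_def by auto
qed

lemma arc_radius_mono_without_zero:
  assumes "circle.game_ball D" "circle.game_ball E" "0 \<notin> D" "E \<subseteq> D"
  shows "arc_radius E \<le> arc_radius D"
proof -
  obtain c r where D: "0 < r" "arc_radius D = r" "D = {c - r..c + r}"
    using game_ball_without_zeroE[OF assms(1,3)] by metis
  have "0 \<notin> E" using assms(3,4) by blast
  with assms(2) obtain b s where E: "0 < s" "arc_radius E = s" "E = {b - s..b + s}"
    by (rule game_ball_without_zeroE) metis
  have "b - s \<in> D" "b + s \<in> D" using assms(4) E by auto
  then show ?thesis using D E by simp
qed

section \<open>The strategy\<close>

text \<open>
  The centre is moved by \<open>r / 2\<close> from \<open>c\<close> towards the antipode \<open>1 / 2\<close> of 0.  The answer then lies at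
  distances between \<open>3 * r / 8\<close> and \<open>5 * r / 8\<close> from \<open>c\<close>, so it leaves 0 behind and, as
  \<open>r \<le> 1 / 2\<close>, does not reach 0 from the other side.
\<close>

lemma first_reply:
  assumes "circle.game_ball D"
  shows "\<exists>E. circle.game_ball E \<and> E \<subseteq> D \<and> arc_radius E = arc_radius D / 8 \<and> 0 \<notin> E"
proof -
  obtain c r where cr: "c \<in> circle" "0 < r" "r \<le> 1/2" "arc_radius D = r"
    and D: "D = {y. c \<in> circle \<and> y \<in> circle \<and> (\<bar>c - y\<bar> \<le> r \<or> 1 - \<bar>c - y\<bar> \<le> r)}"
    using assms by (rule game_ballE)
  define b where "b = (if c \<le> 1/2 then c + r/2 else c - r/2)"
  have b: "0 < b - r/8" "b + r/8 < 1" "\<bar>c - b\<bar> = r/2"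
    using cr by (auto simp: b_def circle_def)
  have "{b - r/8..b + r/8} \<subseteq> D"
  proof
    fix y assume y: "y \<in> {b - r/8..b + r/8}"
    then have "\<bar>c - y\<bar> \<le> r" using b(3) cr(2) unfolding atLeastAtMost_iff by linarith
    then show "y \<in> D" unfolding D using y b cr(1) by (auto simp: circle_def)
  qed
  then show ?thesis
    using interval_game_ball[of "r/8" b] b cr by (intro exI[of _ "{b - r/8..b + r/8}"]) auto
qed

text \<open>
  The two candidates for the answer have centres \<open>c - r / 2\<close> and \<open>c + r / 2\<close>.  They are \<open>3 * r / 4\<close>
  apart, so one endpoint with its segment of length \<open>r / 2\<close> cannot spoil both; two different
  endpoints spoiling one candidate each would have a distance of less than \<open>2 * r\<close>, which
  contradicts the separation of endpoints.
\<close>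

lemma avoiding_reply:
  assumes "circle.game_ball D" "0 \<notin> D"
  shows "\<exists>E. circle.game_ball E \<and> E \<subseteq> D \<and> arc_radius E = arc_radius D / 8 \<and>
    (\<forall>p l. cylinder p l \<longrightarrow> 2 * arc_radius D \<le> l \<longrightarrow> E \<inter> {p..p + arc_radius D / 2} = {})"
proof -
  obtain c r where r: "0 < r" "0 < c - r" "c + r < 1" "arc_radius D = r" "D = {c - r..c + r}"
    using game_ball_without_zeroE[OF assms] by metis
  define avoids where "avoids E \<longleftrightarrow>
    (\<forall>p l. cylinder p l \<longrightarrow> 2 * r \<le> l \<longrightarrow> E \<inter> {p..p + r/2} = {})" for E
  define E where "E b = {b - r/8..b + r/8}" for b
  have ball: "circle.game_ball (E b) \<and> E b \<subseteq> D \<and> arc_radius (E b) = r/8"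
    if "b = c - r/2 \<or> b = c + r/2" for b
    using that interval_game_ball[of "r/8" b] r by (auto simp: E_def)
  have "avoids (E (c - r/2)) \<or> avoids (E (c + r/2))"
  proof (rule ccontr)
    assume "\<not> ?thesis"
    then obtain p l q m x y where
      p: "cylinder p l" "2 * r \<le> l" "x \<in> E (c - r/2)" "x \<in> {p..p + r/2}" and
      q: "cylinder q m" "2 * r \<le> m" "y \<in> E (c + r/2)" "y \<in> {q..q + r/2}"
      unfolding avoids_def by blast
    have "p \<noteq> q" "\<bar>p - q\<bar> < 2 * r"
      using p(3,4) q(3,4) r(1) by (auto simp: E_def)
    then show False using cylinder_separated[OF p(1) q(1)] p(2) q(2) by simp
  qed
  then show ?thesis using ball r(4) unfolding avoids_def by (metis (no_types, lifting))
qed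

text \<open>
  In a ball that contains 0, Player A only gets rid of 0; since later balls miss 0, this happens in
  the first round at most.
\<close>

lemma positional_reply:
  assumes "circle.game_ball D"
  shows "\<exists>E. circle.game_ball E \<and> E \<subseteq> D \<and> arc_radius E = arc_radius D / 8 \<and> 0 \<notin> E \<and>
    (0 \<notin> D \<longrightarrow>
      (\<forall>p l. cylinder p l \<longrightarrow> 2 * arc_radius D \<le> l \<longrightarrow> E \<inter> {p..p + arc_radius D / 2} = {}))"
proof (cases "0 \<in> D")
  case True
  then show ?thesis using first_reply[OF assms] by blast
next
  case False
  then show ?thesis using avoiding_reply[OF assms False] by blast
qed

text \<open>
  The first \<open>n\<close> with \<open>l \<ge> 2 * r n\<close>: either it is 0, and then \<open>l \<le> 1\<close> is used, or it is preceded by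
  a round with \<open>l < 2 * r (n - 1) \<le> 2 * r n / g\<close>.
\<close>

lemma round_treating_length:
  fixes r :: "nat \<Rightarrow> real"
  assumes pos: "\<And>n. 0 < r n" and g: "0 < g"
    and lower: "\<And>n. g * r n \<le> r (Suc n)" and lim: "r \<longlonglongrightarrow> 0"
    and l: "0 < l" "l \<le> 1"
  obtains n where "2 * r n \<le> l" "min (r 0 / 2) (g / 4) * l \<le> r n / 2"
proof -
  have "eventually (\<lambda>n. r n < l / 2) sequentially"
    using order_tendstoD(2)[OF lim, of "l / 2"] l by simp
  then obtain m where "r m < l / 2"
    unfolding eventually_sequentially by blast
  then have m: "2 * r m \<le> l" by simp
  define n where "n = (LEAST n. 2 * r n \<le> l)"
  have n: "2 * r n \<le> l" unfolding n_def using m by (rule LeastI)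
  have "min (r 0 / 2) (g / 4) * l \<le> r n / 2"
  proof (cases n)
    case 0
    have "min (r 0 / 2) (g / 4) * l \<le> r 0 / 2 * 1"
      using pos[of 0] l by (intro mult_mono) auto
    then show ?thesis using 0 by simp
  next
    case (Suc k)
    then have "l < 2 * r k" using not_less_Least[of k "\<lambda>n. 2 * r n \<le> l"] by (simp add: n_def)
    then have "min (r 0 / 2) (g / 4) * l \<le> g / 4 * (2 * r k)"
      using g l by (intro mult_mono) auto
    also have "\<dots> \<le> r n / 2" using lower[of k] Suc by simp
    finally show ?thesis .
  qed
  with n show ?thesis using that by blast
qed

text \<open>
  Here \<open>B\<close> is the course of Player B and \<open>f\<close> the reply function.  The constant \<open>e\<close> comes from
  the rounds after the first one: only from then on is 0 certainly outside the balls of Player B, so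
  that the reply is known to stay clear of endpoints.
\<close>

lemma play_ends_in_bounded_luroth:
  assumes reply: "\<And>D. circle.game_ball D \<Longrightarrow>
      circle.game_ball (f D) \<and> f D \<subseteq> D \<and> arc_radius (f D) = arc_radius D / 8 \<and> 0 \<notin> f D \<and>
      (0 \<notin> D \<longrightarrow>
        (\<forall>p l. cylinder p l \<longrightarrow> 2 * arc_radius D \<le> l \<longrightarrow> f D \<inter> {p..p + arc_radius D / 2} = {}))"
    and \<beta>: "0 < \<beta>"
    and ball: "\<And>n. circle.game_ball (B n)"
    and nested: "\<And>n. B (Suc n) \<subseteq> f (B n)"
    and radius: "\<And>n. \<beta> * arc_radius (f (B n)) \<le> arc_radius (B (Suc n))"
    and x: "\<And>n. x \<in> B n \<inter> f (B n)"
  shows "x \<in> bounded_luroth"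
proof -
  define r where "r n = arc_radius (B (Suc n))" for n
  have no0: "0 \<notin> B (Suc n)" for n using nested[of n] reply[OF ball[of n]] by blast
  have pos: "0 < r n" for n
    using ball[of "Suc n"] by (auto simp: r_def elim: game_ballE)
  have lower: "\<beta> / 8 * r n \<le> r (Suc n)" for n
    using radius[of "Suc n"] reply[OF ball[of "Suc n"]] by (simp add: r_def)
  have upper: "r (Suc n) \<le> r n * (1/8)" for n
    using arc_radius_mono_without_zero[OF _ ball _ nested, of "Suc n"] reply[OF ball[of "Suc n"]]
    by (simp add: r_def)
  have "r n \<le> r 0 * (1/8) ^ n" for n
  proof (induction n)
    case (Suc n)
    then show ?case using upper[of n] by simp
  qed simp
  moreover have "(\<lambda>n. r 0 * (1/8::real) ^ n) \<longlonglongrightarrow> 0"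
    by (intro tendsto_mult_right_zero LIMSEQ_realpow_zero) auto
  ultimately have lim: "r \<longlonglongrightarrow> 0"
    using pos by (intro tendsto_sandwich[of "\<lambda>_. 0" r sequentially "\<lambda>n. r 0 * (1/8) ^ n"])
      (auto intro!: always_eventually less_imp_le)
  define e where "e = min (r 0 / 2) (\<beta> / 8 / 4)"
  have e: "0 < e" using pos[of 0] \<beta> by (simp add: e_def)
  have xc: "x \<in> circle" using x[of 0] ball[of 0] by (auto elim: game_ballE)
  show ?thesis
  proof (rule bounded_luroth_if_far_from_endpoints[OF xc e])
    fix p l assume pl: "cylinder p l" "p \<le> x"
    have l: "0 < l" "l \<le> 1" using cylinder_bounds[OF pl(1)] by auto
    obtain n where n: "2 * r n \<le> l" "e * l \<le> r n / 2"
      using round_treating_length[of r "\<beta> / 8" l] pos \<beta> lower lim l unfolding e_def by auto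
    have "f (B (Suc n)) \<inter> {p..p + r n / 2} = {}"
      using reply[OF ball[of "Suc n"]] no0[of n] pl(1) n(1) unfolding r_def by blast
    then have "p + r n / 2 < x" using x[of "Suc n"] pl(2) by fastforce
    then show "p + e * l \<le> x" using n(2) by simp
  qed
qed

text \<open>
  Both comparisons that occur in the rules lie between equality and \<open>\<ge>\<close>, which is all that the
  argument uses.
\<close>

lemma exists_winning_strategy:
  fixes cmp :: "real \<Rightarrow> real \<Rightarrow> bool"
  assumes refl: "\<And>a. cmp a a" and ge: "\<And>a b. cmp a b \<Longrightarrow> b \<le> a" and \<beta>: "0 < \<beta>"
  shows "\<exists>\<sigma>. circle.winning_strategy cmp (1/8) \<beta> bounded_luroth \<sigma>"
proof -
  obtain f where f: "\<And>D. circle.game_ball D \<Longrightarrow>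
      circle.game_ball (f D) \<and> f D \<subseteq> D \<and> arc_radius (f D) = arc_radius D / 8 \<and> 0 \<notin> f D \<and>
      (0 \<notin> D \<longrightarrow>
        (\<forall>p l. cylinder p l \<longrightarrow> 2 * arc_radius D \<le> l \<longrightarrow> f D \<inter> {p..p + arc_radius D / 2} = {}))"
    using positional_reply by metis
  define \<sigma> where "\<sigma> bs = f (last bs)" for bs
  have ans: "circle.answers \<sigma> B n = f (B n)" for B n
    by (simp add: circle.answers_def \<sigma>_def)
  have ball: "circle.game_ball (B n)" if "circle.legal_B cmp \<beta> (circle.answers \<sigma> B) B n" for B n
    using that unfolding circle.legal_B_def circle.admissible_def by (cases n) auto
  have "circle.winning_strategy cmp (1/8) \<beta> bounded_luroth \<sigma>"
    unfolding circle.winning_strategy_def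
  proof (intro allI conjI impI)
    fix B n assume "\<forall>m\<le>n. circle.legal_B cmp \<beta> (circle.answers \<sigma> B) B m"
    then have b: "circle.game_ball (B n)" using ball by blast
    have "arc_radius (f (B n)) = 1/8 * arc_radius (B n)" using f[OF b] by simp
    then have "cmp (arc_radius (f (B n))) (1/8 * arc_radius (B n))" by (simp only: refl)
    then show "circle.legal_A cmp (1/8) (circle.answers \<sigma> B) B n"
      using f[OF b] unfolding circle.legal_A_def circle.admissible_def ans by blast
  next
    fix B assume legal: "\<forall>n. circle.legal_B cmp \<beta> (circle.answers \<sigma> B) B n"
    have step: "circle.admissible cmp \<beta> (f (B n)) (B (Suc n))" for n
      using legal[rule_format, of "Suc n"] by (simp add: circle.legal_B_def ans)
    show "(\<Inter>n. B n \<inter> circle.answers \<sigma> B n) \<subseteq> bounded_luroth"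
    proof
      fix x assume "x \<in> (\<Inter>n. B n \<inter> circle.answers \<sigma> B n)"
      then have x: "x \<in> B n \<inter> f (B n)" for n by (simp add: ans)
      show "x \<in> bounded_luroth"
      proof (rule play_ends_in_bounded_luroth[OF f \<beta>])
        show "circle.game_ball (B n)" for n using ball legal by blast
        show "B (Suc n) \<subseteq> f (B n)" for n using step unfolding circle.admissible_def by blast
        show "\<beta> * arc_radius (f (B n)) \<le> arc_radius (B (Suc n))" for n
          using step ge unfolding circle.admissible_def by blast
      qed (assumption, rule x)
    qed
  qed
  then show ?thesis by blast
qed

theorem theorem2p1:
  shows "circle.alpha_winning (1/8) bounded_luroth \<and> circle.alpha_strong_winning (1/8) bounded_luroth"
  using exists_winning_strategy[of "(=)"] exists_winning_strategy[of "(\<ge>)"]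
  unfolding circle.alpha_winning_def circle.alpha_beta_winning_def circle.alpha_strong_winning_def
  by auto

end
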